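(* Let $Z_1,Z_2,Z_3\in\mathbb R^2$ be the vertices of a (nondegenerate) triangle and let $d_1,d_2,d_3>0$. Let $X$ be the set of global minimizers over $W\in\mathbb R^2$ of $O(W)=\sum_{j=1}^3\left|\,\|W-Z_j\|^2-d_j^2\right|$. Then $|X|=5$ if and only if, after simultaneously reordering the pairs $(Z_1,d_1),(Z_2,d_2),(Z_3,d_3)$ if necessary, the following all hold: $$\|Z_1Z_3\|=\|Z_2Z_3\|,\qquad \|Z_1Z_3\|>\|Z_1Z_2\|,$$ $$d_1^2=\frac{\|Z_1Z_2\|^2}{4}+\left(\|Z_1Z_3\|^2-\frac{\|Z_1Z_2\|^2}{4}\right)\left(\frac{\|Z_1Z_3\|^2+\|Z_1Z_2\|^2}{\|Z_1Z_3\|^2-\|Z_1Z_2\|^2}\right)^2,$$ $$d_3=\sqrt{d_1^2-\|Z_1Z_3\|^2},\qquad d_2=d_1 .$$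
   Context: $\|Z_iZ_j\|$ denotes the Euclidean distance $\|Z_i-Z_j\|$, and $|X|$ is the number of elements of $X$. *)

theory Defs
  imports "HOL-Analysis.Analysis"
begin

definition objective :: "(nat \<Rightarrow> real^2) \<Rightarrow> (nat \<Rightarrow> real) \<Rightarrow> real^2 \<Rightarrow> real" where
  "objective Z d W = (\<Sum>j\<in>{1..3}. \<bar>(dist W (Z j))\<^sup>2 - (d j)\<^sup>2\<bar>)"

definition global_minimizers :: "(nat \<Rightarrow> real^2) \<Rightarrow> (nat \<Rightarrow> real) \<Rightarrow> (real^2) set" where
  "global_minimizers Z d = {W. \<forall>V. objective Z d W \<le> objective Z d V}"

definition five_point_conditions ::
    "real^2 \<Rightarrow> real^2 \<Rightarrow> real^2 \<Rightarrow> real \<Rightarrow> real \<Rightarrow> real \<Rightarrow> bool" where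
  "five_point_conditions Z1 Z2 Z3 d1 d2 d3 \<longleftrightarrow>
     dist Z1 Z3 = dist Z2 Z3 \<and>
     dist Z1 Z3 > dist Z1 Z2 \<and>
     d1\<^sup>2 = (dist Z1 Z2)\<^sup>2 / 4 +
       ((dist Z1 Z3)\<^sup>2 - (dist Z1 Z2)\<^sup>2 / 4) *
       (((dist Z1 Z3)\<^sup>2 + (dist Z1 Z2)\<^sup>2) / ((dist Z1 Z3)\<^sup>2 - (dist Z1 Z2)\<^sup>2))\<^sup>2 \<and>
     d3 = sqrt (d1\<^sup>2 - (dist Z1 Z3)\<^sup>2) \<and>
     d2 = d1"

end

theory Submission
  imports Defs
begin

text \<open>
  Lift \<open>W\<close> to \<open>(W, \<bar>W\<bar>\<^sup>2)\<close>. Since the triangle is nondegenerate, the three powers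
  \<open>\<bar>W - Z\<^sub>j\<bar>\<^sup>2 - d\<^sub>j\<^sup>2\<close> become affine coordinates of three-space centred at the lifted radical
  centre, and the objective is the \<open>\<ell>\<^sup>1\<close>-norm in these coordinates, to be minimised over a
  paraboloid. If the centre is not strictly above the paraboloid, strict convexity gives a unique
  minimizer. Otherwise the largest octahedron above the paraboloid touches it, again by strict
  convexity, only in vertices, which are intersection points of two of the circles. There are six
  vertices, in three antipodal pairs. If five of them touch, two pairs touch completely, which puts
  the radical centre on two side lines, hence at a vertex \<open>Z\<^sub>3\<close> of the triangle, and makes the
  triangle isosceles; equality with the nearer vertex of the third pair fixes \<open>d\<^sub>1\<close>.
\<close>

section \<open>Linear algebra in the plane\<close>

lemma inner_real2: "(x::real^2) \<bullet> y = x$1 * y$1 + x$2 * y$2"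
  by (simp add: inner_vec_def sum_2)

definition cross2 :: "real^2 \<Rightarrow> real^2 \<Rightarrow> real" where
  "cross2 x y = x$1 * y$2 - x$2 * y$1"

lemma cross2_nonzero:
  assumes "\<not> collinear {a, b, c :: real^2}"
  shows "cross2 (a - c) (b - c) \<noteq> 0"
proof
  assume 0: "cross2 (a - c) (b - c) = 0"
  define x y where "x = a - c" and "y = b - c"
  have xy: "x$1 * y$2 = x$2 * y$1"
    using 0 by (simp add: cross2_def x_def y_def)
  have "collinear {0, x, y}"
  proof (cases "x = 0")
    case False
    then have n: "x \<bullet> x \<noteq> 0" by simp
    have "(x \<bullet> x) * y$1 = (x \<bullet> y) * x$1" "(x \<bullet> x) * y$2 = (x \<bullet> y) * x$2"
      using xy unfolding inner_real2 by algebra+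
    then have "y = ((x \<bullet> y) / (x \<bullet> x)) *\<^sub>R x"
      using n by (simp add: vec_eq_iff forall_2 field_simps)
    then show ?thesis unfolding collinear_lemma by blast
  qed (simp add: collinear_lemma)
  then have "collinear {a, c, b}"
    unfolding x_def y_def by (subst collinear_3) simp
  then show False using assms by (simp add: insert_commute)
qed

text \<open>Cramer's rule; \<open>cross2 a b\<close> is the determinant of the system.\<close>

lemma linear_system_solvable:
  assumes "cross2 a b \<noteq> 0"
  obtains x where "x \<bullet> a = \<alpha>" and "x \<bullet> b = \<beta>"
proof
  define x :: "real^2" where
    "x = (\<chi> i. if i = 1 then (\<alpha> * b$2 - \<beta> * a$2) / cross2 a b else (\<beta> * a$1 - \<alpha> * b$1) / cross2 a b)"
  have x: "x$1 = (\<alpha> * b$2 - \<beta> * a$2) / cross2 a b" "x$2 = (\<beta> * a$1 - \<alpha> * b$1) / cross2 a b"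
    by (simp_all add: x_def)
  show "x \<bullet> a = \<alpha>" "x \<bullet> b = \<beta>"
    using assms unfolding inner_real2 x by (simp_all add: field_simps) (simp_all add: cross2_def algebra_simps)
qed

lemma orthogonal_both_zero:
  assumes "cross2 a b \<noteq> 0" "x \<bullet> a = 0" "x \<bullet> b = 0"
  shows "x = 0"
proof -
  have "cross2 a b * x$1 = 0" "cross2 a b * x$2 = 0"
    using assms(2,3) unfolding inner_real2 cross2_def by algebra+
  then show ?thesis using assms(1) by (simp add: vec_eq_iff forall_2)
qed

lemma Lagrange_identity_2: "(x \<bullet> x) * (y \<bullet> y) - (x \<bullet> y)\<^sup>2 = (cross2 x y)\<^sup>2"
  unfolding inner_real2 cross2_def by algebra

section \<open>Reduction to coordinates at the radical centre\<close>

text \<open>With the origin at the radical centre of the three circles, whose power is \<open>- p\<close>,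
  this is the power of \<open>w\<close> with respect to the circle of centre \<open>z\<close>.\<close>

definition cpow :: "real \<Rightarrow> real^2 \<Rightarrow> real^2 \<Rightarrow> real" where
  "cpow p z w = w \<bullet> w - 2 * (w \<bullet> z) - p"

text \<open>The centres are separate arguments, so that relabelling the vertices only permutes
  arguments while the origin and \<open>p\<close> stay fixed.\<close>

definition obj3 :: "real \<Rightarrow> real^2 \<Rightarrow> real^2 \<Rightarrow> real^2 \<Rightarrow> real^2 \<Rightarrow> real" where
  "obj3 p z1 z2 z3 w = \<bar>cpow p z1 w\<bar> + \<bar>cpow p z2 w\<bar> + \<bar>cpow p z3 w\<bar>"

definition mins3 :: "real \<Rightarrow> real^2 \<Rightarrow> real^2 \<Rightarrow> real^2 \<Rightarrow> (real^2) set" where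
  "mins3 p z1 z2 z3 = {w. \<forall>v. obj3 p z1 z2 z3 w \<le> obj3 p z1 z2 z3 v}"

lemma mins3_rotate: "mins3 p z1 z2 z3 = mins3 p z2 z3 z1"
  by (simp add: mins3_def obj3_def algebra_simps)

lemma mins3_swap: "mins3 p z1 z2 z3 = mins3 p z2 z1 z3"
  by (simp add: mins3_def obj3_def algebra_simps)

text \<open>The hypothesis says that \<open>W0\<close> has the same power \<open>- p\<close> with
  respect to all three circles, so translation by \<open>W0\<close> gives the three quadratics a
  common constant term.\<close>

lemma objective_eq_obj3:
  assumes "\<And>j. j \<in> {1,2,3} \<Longrightarrow> (d j)\<^sup>2 = (Z j - W0) \<bullet> (Z j - W0) + p"
  shows "objective Z d (W0 + w) = obj3 p (Z 1 - W0) (Z 2 - W0) (Z 3 - W0) w"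
proof -
  have *: "(dist (W0 + w) (Z j))\<^sup>2 - (d j)\<^sup>2 = cpow p (Z j - W0) w" if "j \<in> {1,2,3}" for j
    unfolding assms[OF that] dist_norm power2_norm_eq_inner cpow_def
    by (simp add: inner_diff inner_add inner_commute)
  have "{1..3} = {1, 2, 3::nat}" by auto
  then show ?thesis by (simp add: objective_def obj3_def *)
qed

lemma global_minimizers_eq_mins3:
  assumes "\<And>j. j \<in> {1,2,3} \<Longrightarrow> (d j)\<^sup>2 = (Z j - W0) \<bullet> (Z j - W0) + p"
  shows "global_minimizers Z d = (+) W0 ` mins3 p (Z 1 - W0) (Z 2 - W0) (Z 3 - W0)"
proof -
  have o: "objective Z d W = obj3 p (Z 1 - W0) (Z 2 - W0) (Z 3 - W0) (W - W0)" for W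
    using objective_eq_obj3[OF assms, where w = "W - W0"] by simp
  show ?thesis
  proof (intro equalityI subsetI)
    fix W assume "W \<in> global_minimizers Z d"
    then have "obj3 p (Z 1 - W0) (Z 2 - W0) (Z 3 - W0) (W - W0)
        \<le> obj3 p (Z 1 - W0) (Z 2 - W0) (Z 3 - W0) v" for v
      unfolding global_minimizers_def o by (auto dest: spec[of _ "W0 + v"])
    then have "W - W0 \<in> mins3 p (Z 1 - W0) (Z 2 - W0) (Z 3 - W0)"
      by (simp add: mins3_def)
    then show "W \<in> (+) W0 ` mins3 p (Z 1 - W0) (Z 2 - W0) (Z 3 - W0)"
      by (intro image_eqI[of _ _ "W - W0"]) auto
  qed (auto simp: global_minimizers_def mins3_def o)
qed

lemma card_global_minimizers:
  assumes "\<And>j. j \<in> {1,2,3} \<Longrightarrow> (d j)\<^sup>2 = (Z j - W0) \<bullet> (Z j - W0) + p"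
  shows "card (global_minimizers Z d) = card (mins3 p (Z 1 - W0) (Z 2 - W0) (Z 3 - W0))"
  by (subst global_minimizers_eq_mins3[OF assms]) (simp_all only: card_image inj_on_add)

text \<open>Subtracting the third equation from the other two cancels the quadratic terms in
  \<open>W0\<close> and leaves a linear system with determinant
  \<open>cross2 (Z1 - Z3) (Z2 - Z3)\<close>; the third equation then defines
  \<open>p\<close>.\<close>

lemma radical_center_exists:
  assumes "cross2 (Z1 - Z3) (Z2 - Z3) \<noteq> 0"
  obtains W0 p where "(d1::real)\<^sup>2 = (Z1 - W0) \<bullet> (Z1 - W0) + p"
    "(d2::real)\<^sup>2 = (Z2 - W0) \<bullet> (Z2 - W0) + p"
    "(d3::real)\<^sup>2 = (Z3 - W0) \<bullet> (Z3 - W0) + p"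
proof -
  obtain W0 where W0: "W0 \<bullet> (Z1 - Z3) = (Z1 \<bullet> Z1 - d1\<^sup>2 - Z3 \<bullet> Z3 + d3\<^sup>2) / 2"
    "W0 \<bullet> (Z2 - Z3) = (Z2 \<bullet> Z2 - d2\<^sup>2 - Z3 \<bullet> Z3 + d3\<^sup>2) / 2"
    using linear_system_solvable[OF assms] by metis
  show thesis
    by (rule that[of W0 "d3\<^sup>2 - (Z3 - W0) \<bullet> (Z3 - W0)"])
       (use W0 in \<open>simp_all add: inner_diff inner_commute field_simps\<close>)
qed

section \<open>Uniqueness when the centre is not strictly above the paraboloid\<close>

text \<open>The midpoint of two distinct lifted minimizers is strictly above the paraboloid and the
  centre \<open>(0, p)\<close> is not, so the segment between them meets the paraboloid. Moving
  towards the centre shrinks all powers by a factor \<open>t < 1\<close>, so the minimum must be 0,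
  and then the vanishing powers determine the point.\<close>

lemma mins3_unique:
  assumes nd: "cross2 (z1 - z3) (z2 - z3) \<noteq> 0" and p: "p \<le> 0"
    and w: "w \<in> mins3 p z1 z2 z3" and v: "v \<in> mins3 p z1 z2 z3"
  shows "w = v"
proof (rule ccontr)
  assume wv: "w \<noteq> v"
  \<comment> \<open>\<open>(m, \<sigma>)\<close> is the midpoint of the lifted points, and
    \<open>g z\<close> below is the affine extension of the power evaluated there.\<close>
  define m \<sigma> where "m = (1/2) *\<^sub>R (w + v)" and "\<sigma> = (w \<bullet> w + v \<bullet> v) / 2"
  define g where "g = (\<lambda>z. (cpow p z w + cpow p z v) / 2)"
  have g: "g z = \<sigma> - 2 * (m \<bullet> z) - p" for z
    by (simp add: g_def \<sigma>_def m_def cpow_def inner_add field_simps)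
  have eqO: "obj3 p z1 z2 z3 w = obj3 p z1 z2 z3 v"
    using w v by (auto simp: mins3_def intro: antisym)
  have "m \<bullet> m - \<sigma> = - ((w - v) \<bullet> (w - v)) / 4"
    by (simp add: m_def \<sigma>_def inner_add inner_diff inner_commute field_simps)
  moreover have "(w - v) \<bullet> (w - v) > 0" using wv by simp
  ultimately have ms: "m \<bullet> m < \<sigma>" by linarith
  \<comment> \<open>\<open>\<phi> t\<close> compares the paraboloid over
    \<open>t *\<^sub>R m\<close> with the segment from \<open>(0, p)\<close> to
    \<open>(m, \<sigma>)\<close>; a zero is a crossing.\<close>
  define \<phi> where "\<phi> = (\<lambda>t::real. t\<^sup>2 * (m \<bullet> m) - t * \<sigma> - (1 - t) * p)"
  have "\<exists>t\<ge>0. t \<le> 1 \<and> \<phi> t = 0"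
  proof (rule IVT2')
    show "\<phi> 1 \<le> 0" "0 \<le> \<phi> 0" using ms p by (auto simp: \<phi>_def)
    show "continuous_on {0..1} \<phi>" unfolding \<phi>_def by (intro continuous_intros)
  qed simp
  then obtain t where t: "0 \<le> t" "t \<le> 1" "\<phi> t = 0" by blast
  have "t \<noteq> 1" using t(3) ms by (auto simp: \<phi>_def)
  then have t1: "t < 1" using t by simp
  have c: "cpow p z (t *\<^sub>R m) = t * g z" for z
    using t(3) unfolding cpow_def g \<phi>_def by (simp add: power2_eq_square algebra_simps)
  define G where "G = \<bar>g z1\<bar> + \<bar>g z2\<bar> + \<bar>g z3\<bar>"
  have "G \<le> obj3 p z1 z2 z3 w"
  proof -
    have "\<bar>(x + y) / 2\<bar> \<le> (\<bar>x\<bar> + \<bar>y\<bar>) / 2" for x y :: real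
      using abs_triangle_ineq[of x y] by simp
    from this[of "cpow p z1 w" "cpow p z1 v"] this[of "cpow p z2 w" "cpow p z2 v"]
      this[of "cpow p z3 w" "cpow p z3 v"]
    show ?thesis using eqO unfolding G_def g_def obj3_def by argo
  qed
  moreover have "obj3 p z1 z2 z3 w \<le> obj3 p z1 z2 z3 (t *\<^sub>R m)"
    using w by (simp add: mins3_def)
  moreover have "obj3 p z1 z2 z3 (t *\<^sub>R m) = t * G"
    using t(1) by (simp add: obj3_def c G_def abs_mult algebra_simps)
  ultimately have le: "obj3 p z1 z2 z3 w \<le> t * G" "G \<le> t * G" by auto
  have "(1 - t) * G \<le> 0" using le by (simp add: algebra_simps)
  then have "G \<le> 0" using t1 by (simp add: mult_le_0_iff)
  moreover have "G \<ge> 0" by (simp add: G_def)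
  ultimately have "obj3 p z1 z2 z3 w \<le> 0" using le by auto
  then have "cpow p z1 w = 0" "cpow p z2 w = 0" "cpow p z3 w = 0"
    "cpow p z1 v = 0" "cpow p z2 v = 0" "cpow p z3 v = 0"
    using eqO unfolding obj3_def by auto
  then have "(w - v) \<bullet> (z1 - z3) = 0" "(w - v) \<bullet> (z2 - z3) = 0"
    unfolding cpow_def inner_diff by linarith+
  then show False using orthogonal_both_zero[OF nd, of "w - v"] wv by simp
qed

section \<open>The octahedron above the paraboloid\<close>

text \<open>In the lifted picture \<open>(e\<^sub>k, s\<^sub>k)\<close> is \<open>r\<close> times the \<open>k\<close>-th vector of the basis dual to
  the powers, so the vertices of the octahedron are \<open>(0, p) \<plusminus> (e\<^sub>k, s\<^sub>k)\<close>; they lie in the region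
  above the paraboloid when \<open>e\<^sub>k \<bullet> e\<^sub>k + \<bar>s\<^sub>k\<bar> \<le> p\<close>.\<close>

lemma octahedron_bound:
  fixes e1 e2 e3 z1 z2 z3 w :: "real^2" and r p s1 s2 s3 :: real
  assumes nd: "cross2 (z1 - z3) (z2 - z3) \<noteq> 0" and r: "r > 0" and p: "p > 0"
    and e1: "s1 - 2 * (e1 \<bullet> z1) = r" "s1 - 2 * (e1 \<bullet> z2) = 0" "s1 - 2 * (e1 \<bullet> z3) = 0"
    and e2: "s2 - 2 * (e2 \<bullet> z1) = 0" "s2 - 2 * (e2 \<bullet> z2) = r" "s2 - 2 * (e2 \<bullet> z3) = 0"
    and e3: "s3 - 2 * (e3 \<bullet> z1) = 0" "s3 - 2 * (e3 \<bullet> z2) = 0" "s3 - 2 * (e3 \<bullet> z3) = r"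
    and le: "e1 \<bullet> e1 + \<bar>s1\<bar> \<le> p" "e2 \<bullet> e2 + \<bar>s2\<bar> \<le> p" "e3 \<bullet> e3 + \<bar>s3\<bar> \<le> p"
  shows "r \<le> obj3 p z1 z2 z3 w"
    and "obj3 p z1 z2 z3 w = r \<Longrightarrow> cpow p z1 w * cpow p z2 w = 0 \<and>
      cpow p z1 w * cpow p z3 w = 0 \<and> cpow p z2 w * cpow p z3 w = 0"
proof -
  \<comment> \<open>\<open>a\<close>, \<open>b\<close>, \<open>c\<close> are the coordinates of the
    lifted \<open>w\<close> relative to \<open>(0, p)\<close> in the basis \<open>(e1, s1)\<close>,
    \<open>(e2, s2)\<close>, \<open>(e3, s3)\<close>. The remainder \<open>(x, y)\<close> is
    annihilated by all three linear forms, hence zero.\<close>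
  define a b c where "a = cpow p z1 w / r" and "b = cpow p z2 w / r" and "c = cpow p z3 w / r"
  define x y where "x = w - (a *\<^sub>R e1 + b *\<^sub>R e2 + c *\<^sub>R e3)"
    and "y = w \<bullet> w - p - (a * s1 + b * s2 + c * s3)"
  have fr: "cpow p z1 w = a * r" "cpow p z2 w = b * r" "cpow p z3 w = c * r"
    using r by (simp_all add: a_def b_def c_def)
  have xy_z: "y - 2 * (x \<bullet> z) = cpow p z w
      - (a * (s1 - 2 * (e1 \<bullet> z)) + b * (s2 - 2 * (e2 \<bullet> z)) + c * (s3 - 2 * (e3 \<bullet> z)))" for z
    by (simp add: x_def y_def cpow_def inner_diff inner_add algebra_simps)
  have xy: "y - 2 * (x \<bullet> z1) = 0" "y - 2 * (x \<bullet> z2) = 0" "y - 2 * (x \<bullet> z3) = 0"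
    unfolding xy_z fr e1 e2 e3 by simp_all
  then have "x \<bullet> (z1 - z3) = 0" "x \<bullet> (z2 - z3) = 0" unfolding inner_diff by linarith+
  then have x0: "x = 0" by (rule orthogonal_both_zero[OF nd])
  with xy have y0: "y = 0" by simp
  have ww: "w = a *\<^sub>R e1 + b *\<^sub>R e2 + c *\<^sub>R e3" using x0 by (simp add: x_def)
  have wp: "w \<bullet> w = p + (a * s1 + b * s2 + c * s3)" using y0 by (simp add: y_def)
  define G where "G = \<bar>a\<bar> + \<bar>b\<bar> + \<bar>c\<bar>"
  have OG: "obj3 p z1 z2 z3 w = r * G"
    using r by (simp add: obj3_def fr G_def abs_mult algebra_simps)
  \<comment> \<open>The sum of the three \<open>T\<close> terms is the defect in the convexity
    inequality for the squared norm: \<open>G\<close> times the weighted sum of the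
    \<open>e \<bullet> e\<close>, minus \<open>w \<bullet> w\<close>. Each is a multiple of a
    squared norm, hence nonnegative.\<close>
  define T where "T = (\<lambda>k l (e::real^2) e'. \<bar>k::real\<bar> * \<bar>l\<bar> * (e \<bullet> e + e' \<bullet> e') - 2 * (k * l * (e \<bullet> e')))"
  have T: "T k l e e' = \<bar>k\<bar> * \<bar>l\<bar> * ((e - (sgn k * sgn l) *\<^sub>R e') \<bullet> (e - (sgn k * sgn l) *\<^sub>R e'))" for k l e e'
  proof -
    have "\<bar>k\<bar> * (sgn k) = k" "\<bar>l\<bar> * (sgn l) = l"
      "\<bar>k\<bar> * (sgn k * sgn k) = \<bar>k\<bar>" "\<bar>l\<bar> * (sgn l * sgn l) = \<bar>l\<bar>"
      by (auto simp: sgn_if abs_if)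
    moreover have "A * B * (x - m * n * y - m * n * (y - m * n * z))
        = A * B * x + (A * (m * m)) * (B * (n * n)) * z - 2 * ((A * m) * (B * n) * y)"
      for A B m n x y z :: real by algebra
    ultimately show ?thesis
      unfolding T_def inner_diff inner_scaleR_left inner_scaleR_right inner_commute[of e' e]
      by (simp add: distrib_left)
  qed
  have T0: "T k l e e' \<ge> 0" for k l e e' unfolding T by simp
  have "w \<bullet> w = G * (\<bar>a\<bar> * (e1 \<bullet> e1) + \<bar>b\<bar> * (e2 \<bullet> e2) + \<bar>c\<bar> * (e3 \<bullet> e3))
      - T a b e1 e2 - T a c e1 e3 - T b c e2 e3"
  proof -
    have "\<bar>a\<bar> * \<bar>a\<bar> = a * a" "\<bar>b\<bar> * \<bar>b\<bar> = b * b" "\<bar>c\<bar> * \<bar>c\<bar> = c * c" by simp_all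
    then show ?thesis
      unfolding ww T_def G_def inner_add inner_scaleR_left inner_scaleR_right
        inner_commute[of e2 e1] inner_commute[of e3 e1] inner_commute[of e3 e2]
      by algebra
  qed
  then have p_eq: "p = G * (\<bar>a\<bar> * (e1 \<bullet> e1) + \<bar>b\<bar> * (e2 \<bullet> e2) + \<bar>c\<bar> * (e3 \<bullet> e3))
      - (a * s1 + b * s2 + c * s3) - (T a b e1 e2 + T a c e1 e3 + T b c e2 e3)"
    using wp by linarith
  \<comment> \<open>For \<open>G \<le> 1\<close> the contribution of each axis is at most
    \<open>\<bar>k\<bar> * p\<close> by the corresponding assumption in \<open>le\<close>; summing
    gives \<open>G * p\<close>. With \<open>G < 1\<close> this contradicts
    \<open>p > 0\<close>.\<close>
  have main: "p + (T a b e1 e2 + T a c e1 e3 + T b c e2 e3) \<le> G * p" if "G \<le> 1"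
  proof -
    have *: "G * (\<bar>k\<bar> * (e \<bullet> e)) - k * s \<le> \<bar>k\<bar> * p"
      if "e \<bullet> e + \<bar>s\<bar> \<le> p" for k s and e :: "real^2"
    proof -
      have "G * (\<bar>k\<bar> * (e \<bullet> e)) \<le> 1 * (\<bar>k\<bar> * (e \<bullet> e))"
        by (rule mult_right_mono[OF \<open>G \<le> 1\<close>]) simp
      moreover have "- (k * s) \<le> \<bar>k\<bar> * \<bar>s\<bar>" by (metis abs_ge_minus_self abs_mult)
      moreover have "\<bar>k\<bar> * (e \<bullet> e + \<bar>s\<bar>) \<le> \<bar>k\<bar> * p" using that by (simp add: mult_left_mono)
      ultimately show ?thesis by (simp add: algebra_simps)
    qed
    have "G * p = \<bar>a\<bar> * p + \<bar>b\<bar> * p + \<bar>c\<bar> * p" by (simp add: G_def algebra_simps)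
    then show ?thesis
      using *[OF le(1), of a] *[OF le(2), of b] *[OF le(3), of c] p_eq
      by (simp only: distrib_left)
  qed
  have G1: "1 \<le> G"
  proof (rule ccontr)
    assume "\<not> 1 \<le> G"
    then have G: "G < 1" by simp
    then have "p \<le> G * p" using main T0[of a b e1 e2] T0[of a c e1 e3] T0[of b c e2 e3] by linarith
    then show False using G p by simp
  qed
  then show "r \<le> obj3 p z1 z2 z3 w" using OG r by simp
  assume "obj3 p z1 z2 z3 w = r"
  then have "G = 1" using OG r by simp
  \<comment> \<open>At \<open>G = 1\<close> no convexity defect is left. Since no \<open>e\<close>
    is a multiple of a later one, a vanishing \<open>T\<close> forces one of its two coefficients to
    be 0.\<close>
  then have "T a b e1 e2 = 0" "T a c e1 e3 = 0" "T b c e2 e3 = 0"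
    using main T0[of a b e1 e2] T0[of a c e1 e3] T0[of b c e2 e3] by auto
  moreover have "e1 \<noteq> k *\<^sub>R e2" for k
  proof
    assume "e1 = k *\<^sub>R e2"
    then have "e1 \<bullet> z1 = k * (e2 \<bullet> z1)" "e1 \<bullet> z3 = k * (e2 \<bullet> z3)" by simp_all
    then show False using e1 e2 r by (smt (verit))
  qed
  moreover have "e1 \<noteq> k *\<^sub>R e3" for k
  proof
    assume "e1 = k *\<^sub>R e3"
    then have "e1 \<bullet> z1 = k * (e3 \<bullet> z1)" "e1 \<bullet> z2 = k * (e3 \<bullet> z2)" by simp_all
    then show False using e1 e3 r by (smt (verit))
  qed
  moreover have "e2 \<noteq> k *\<^sub>R e3" for k
  proof
    assume "e2 = k *\<^sub>R e3"
    then have "e2 \<bullet> z1 = k * (e3 \<bullet> z1)" "e2 \<bullet> z2 = k * (e3 \<bullet> z2)" by simp_all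
    then show False using e2 e3 r by (smt (verit))
  qed
  ultimately have "a * b = 0" "a * c = 0" "b * c = 0"
    unfolding T by auto
  then show "cpow p z1 w * cpow p z2 w = 0 \<and> cpow p z1 w * cpow p z3 w = 0 \<and> cpow p z2 w * cpow p z3 w = 0"
    by (auto simp: fr)
qed

text \<open>A vertex outside the region would leave a point of the paraboloid on the segment towards
  the centre, with smaller objective.\<close>

lemma minimal_vertex_inside:
  assumes p: "p > 0" and r: "r > 0" and min: "\<And>v. r \<le> obj3 p z1 z2 z3 v"
    and e: "s - 2 * (e \<bullet> z1) = r" "s - 2 * (e \<bullet> z2) = 0" "s - 2 * (e \<bullet> z3) = 0"
  shows "e \<bullet> e + \<bar>s\<bar> \<le> p"
proof (rule ccontr)
  assume n: "\<not> e \<bullet> e + \<bar>s\<bar> \<le> p"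
  \<comment> \<open>The sign \<open>k\<close> selects the lower of the two antipodal vertices, at
    height \<open>p - \<bar>s\<bar>\<close>, which is the one below the paraboloid.\<close>
  define k :: real where "k = (if s \<ge> 0 then - 1 else 1)"
  have k: "k * k = 1" "\<bar>k\<bar> = 1" "k * s = - \<bar>s\<bar>" by (auto simp: k_def)
  define \<phi> where "\<phi> = (\<lambda>t::real. t\<^sup>2 * (e \<bullet> e) + t * \<bar>s\<bar> - p)"
  have "\<exists>t\<ge>0. t \<le> 1 \<and> \<phi> t = 0"
  proof (rule IVT')
    show "\<phi> 0 \<le> 0" "0 \<le> \<phi> 1" using n p by (auto simp: \<phi>_def)
    show "continuous_on {0..1} \<phi>" unfolding \<phi>_def by (intro continuous_intros)
  qed simp
  then obtain t where t: "0 \<le> t" "t \<le> 1" "\<phi> t = 0" by blast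
  have "t \<noteq> 1" using t(3) n by (auto simp: \<phi>_def)
  then have t1: "t < 1" using t by simp
  have c: "cpow p z ((k * t) *\<^sub>R e) = k * t * (s - 2 * (e \<bullet> z))" for z
  proof -
    have "cpow p z ((k * t) *\<^sub>R e) = (k * k) * t\<^sup>2 * (e \<bullet> e) - 2 * k * t * (e \<bullet> z) - p"
      by (simp add: cpow_def power2_eq_square)
    also have "\<dots> = k * t * (s - 2 * (e \<bullet> z)) + (t\<^sup>2 * (e \<bullet> e) - t * (k * s) - p)"
      unfolding k(1) by (simp add: algebra_simps)
    also have "t\<^sup>2 * (e \<bullet> e) - t * (k * s) - p = 0"
      using t(3) unfolding k(3) \<phi>_def by simp
    finally show ?thesis by simp
  qed
  \<comment> \<open>On this axis only the first power is nonzero, so the crossing point beats the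
    assumed minimum \<open>r\<close>.\<close>
  have "obj3 p z1 z2 z3 ((k * t) *\<^sub>R e) = t * r"
    unfolding obj3_def c e using r t(1) k(2) by (simp add: abs_mult)
  then have "r \<le> t * r" using min by metis
  then show False using t1 r by simp
qed

text \<open>If the minimum \<open>r\<close> is positive, the octahedron of radius \<open>r\<close>
  lies above the paraboloid, because a vertex below it would give a smaller value. The equality case
  of \<open>octahedron_bound\<close> then applies. If the minimum is 0, all powers vanish.\<close>

lemma two_powers_vanish:
  assumes nd: "cross2 (z1 - z3) (z2 - z3) \<noteq> 0" and p: "p > 0" and w: "w \<in> mins3 p z1 z2 z3"
  shows "cpow p z1 w * cpow p z2 w = 0 \<and> cpow p z1 w * cpow p z3 w = 0 \<and> cpow p z2 w * cpow p z3 w = 0"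
proof (cases "obj3 p z1 z2 z3 w = 0")
  case True
  then show ?thesis 
    by (simp add: obj3_def add_nonneg_eq_0_iff)
next
  case False
  define r where "r = obj3 p z1 z2 z3 w"
  have r: "r > 0" using False by (auto simp: r_def obj3_def)
  have min: "r \<le> obj3 p z1 z2 z3 v" for v using w by (simp add: mins3_def r_def)
  \<comment> \<open>The dual basis is found from differences of the equations, which eliminate the
    heights; each height is then twice the inner product with a vertex whose power has to
    vanish.\<close>
  obtain e1 where "e1 \<bullet> (z1 - z3) = - r / 2" "e1 \<bullet> (z2 - z3) = 0"
    using linear_system_solvable[OF nd] by metis
  then have e1: "2 * (e1 \<bullet> z3) - 2 * (e1 \<bullet> z1) = r" "2 * (e1 \<bullet> z3) - 2 * (e1 \<bullet> z2) = 0"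
    "2 * (e1 \<bullet> z3) - 2 * (e1 \<bullet> z3) = 0" unfolding inner_diff by auto
  obtain e2 where "e2 \<bullet> (z1 - z3) = 0" "e2 \<bullet> (z2 - z3) = - r / 2"
    using linear_system_solvable[OF nd] by metis
  then have e2: "2 * (e2 \<bullet> z3) - 2 * (e2 \<bullet> z1) = 0" "2 * (e2 \<bullet> z3) - 2 * (e2 \<bullet> z2) = r"
    "2 * (e2 \<bullet> z3) - 2 * (e2 \<bullet> z3) = 0" unfolding inner_diff by auto
  obtain e3 where "e3 \<bullet> (z1 - z3) = r / 2" "e3 \<bullet> (z2 - z3) = r / 2"
    using linear_system_solvable[OF nd] by metis
  then have e3: "2 * (e3 \<bullet> z1) - 2 * (e3 \<bullet> z1) = 0" "2 * (e3 \<bullet> z1) - 2 * (e3 \<bullet> z2) = 0"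
    "2 * (e3 \<bullet> z1) - 2 * (e3 \<bullet> z3) = r" unfolding inner_diff by auto
  have min': "r \<le> obj3 p z2 z1 z3 v" "r \<le> obj3 p z3 z1 z2 v" for v
    using min[of v] by (simp_all add: obj3_def)
  note le = minimal_vertex_inside[OF p r min e1]
    minimal_vertex_inside[OF p r min'(1) e2(2,1,3)]
    minimal_vertex_inside[OF p r min'(2) e3(3,1,2)]
  show ?thesis
    by (rule octahedron_bound(2)[OF nd r p e1 e2 e3 le]) (simp add: r_def)
qed

section \<open>Two minimizers on one axis and the resulting configuration\<close>

text \<open>Equal objectives make the remaining powers agree up to sign; the same sign would give
  \<open>w = v\<close>. With opposite signs the lifted points are symmetric about
  \<open>(0, p)\<close>, so \<open>w + v = 0\<close>. For \<open>p > 0\<close> the orthogonality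
  puts the radical centre on the line through \<open>z2\<close> and \<open>z3\<close>.\<close>

lemma antipodal_minimizers:
  assumes nd: "cross2 (z1 - z3) (z2 - z3) \<noteq> 0"
    and w: "w \<in> mins3 p z1 z2 z3" "cpow p z2 w = 0" "cpow p z3 w = 0"
    and v: "v \<in> mins3 p z1 z2 z3" "cpow p z2 v = 0" "cpow p z3 v = 0"
    and wv: "w \<noteq> v"
  shows "v = - w" "w \<bullet> z2 = 0" "w \<bullet> z3 = 0" "w \<bullet> w = p"
proof -
  have "obj3 p z1 z2 z3 w = obj3 p z1 z2 z3 v"
    using w v by (auto simp: mins3_def intro: antisym)
  then have "\<bar>cpow p z1 w\<bar> = \<bar>cpow p z1 v\<bar>" using w v by (simp add: obj3_def)
  moreover have "cpow p z1 w \<noteq> cpow p z1 v"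
  proof
    assume "cpow p z1 w = cpow p z1 v"
    then have "(w - v) \<bullet> (z1 - z3) = 0" "(w - v) \<bullet> (z2 - z3) = 0"
      using w(2,3) v(2,3) unfolding cpow_def inner_diff by linarith+
    then show False using orthogonal_both_zero[OF nd, of "w - v"] wv by simp
  qed
  ultimately have "cpow p z1 w = - cpow p z1 v" by linarith
  then have "(w + v) \<bullet> (z1 - z3) = 0" "(w + v) \<bullet> (z2 - z3) = 0"
    using w(2,3) v(2,3) unfolding cpow_def inner_add inner_diff by linarith+
  then have "w + v = 0" by (rule orthogonal_both_zero[OF nd])
  then show vw: "v = - w" by (simp add: eq_neg_iff_add_eq_0 add.commute)
  show "w \<bullet> z2 = 0" "w \<bullet> z3 = 0" "w \<bullet> w = p"
    using w(2,3) v(2,3) by (auto simp: vw cpow_def)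
qed

lemma cross2_commute: "cross2 y x = - cross2 x y"
  by (simp add: cross2_def)

text \<open>For nonzero \<open>b\<close>, the vector \<open>x\<close> is a multiple \<open>t\<close>
  of \<open>b\<close> turned by a right angle, so both sides equal \<open>t\<close> squared times
  \<open>(b \<bullet> b) * (cross2 a b)\<^sup>2\<close>.\<close>

lemma inner_self_of_orthogonal:
  assumes "x \<bullet> b = 0"
  shows "(x \<bullet> x) * (cross2 a b)\<^sup>2 = (x \<bullet> a)\<^sup>2 * (b \<bullet> b)"
  using assms unfolding inner_real2 cross2_def by algebra

text \<open>Two full axes, through \<open>w\<close> and \<open>v\<close>, put the radical centre at
  \<open>z3\<close>; their equal objectives make the triangle isosceles. The third minimizer
  \<open>u\<close> lies on the symmetry axis, and its position \<open>- \<mu>\<close> there is fixed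
  by equality of its objective with that of \<open>w\<close>.\<close>

lemma five_minimizers_configuration:
  assumes nd: "cross2 (z1 - z3) (z2 - z3) \<noteq> 0" and p: "p > 0"
    and w: "w \<in> mins3 p z1 z2 z3" "w \<bullet> z2 = 0" "w \<bullet> z3 = 0" "w \<bullet> w = p"
    and v: "v \<in> mins3 p z1 z2 z3" "v \<bullet> z1 = 0" "v \<bullet> z3 = 0" "v \<bullet> v = p"
    and u: "u \<in> mins3 p z1 z2 z3" "cpow p z1 u = 0" "cpow p z2 u = 0"
  obtains \<mu> where "z3 = 0" "z1 \<bullet> z1 = z2 \<bullet> z2" "\<mu> > 0"
    "\<mu> * (z1 \<bullet> z1) = 2 * (\<mu> + 1) * (z1 \<bullet> z1 - z1 \<bullet> z2)"
    "p = 2 * (z1 \<bullet> z1 + z1 \<bullet> z2) * \<mu> * (\<mu> + 1)"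
proof -
  have same: "obj3 p z1 z2 z3 x = obj3 p z1 z2 z3 y"
    if "x \<in> mins3 p z1 z2 z3" "y \<in> mins3 p z1 z2 z3" for x y
    using that by (auto simp: mins3_def intro: antisym)
  \<comment> \<open>If \<open>w\<close> and \<open>v\<close> were parallel, \<open>w\<close> would
    be orthogonal to all three centres and hence zero.\<close>
  have "cross2 w v \<noteq> 0"
  proof
    assume "cross2 w v = 0"
    then have "(v \<bullet> v) * (w \<bullet> z1) = 0"
      using v(2) unfolding inner_real2 cross2_def by algebra
    then have "w \<bullet> z1 = 0" using v(4) p by simp
    then have "w = 0"
      using orthogonal_both_zero[OF nd, of w] w by (simp add: inner_diff)
    then show False using w(4) p by simp
  qed
  then have z3: "z3 = 0"
    by (rule orthogonal_both_zero) (use w(3) v(3) in \<open>simp_all add: inner_commute\<close>)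
  define \<Delta> where "\<Delta> = cross2 z1 z2"
  have \<Delta>: "\<Delta> \<noteq> 0" using nd z3 by (simp add: \<Delta>_def)
  have wz: "p * \<Delta>\<^sup>2 = (w \<bullet> z1)\<^sup>2 * (z2 \<bullet> z2)"
    using inner_self_of_orthogonal[OF w(2), of z1] w(4) by (simp add: \<Delta>_def)
  have vz: "p * \<Delta>\<^sup>2 = (v \<bullet> z2)\<^sup>2 * (z1 \<bullet> z1)"
    using inner_self_of_orthogonal[OF v(2), of z2] v(4) by (simp add: \<Delta>_def cross2_commute[of z2])
  have Ow: "obj3 p z1 z2 z3 w = 2 * \<bar>w \<bullet> z1\<bar>" and Ov: "obj3 p z1 z2 z3 v = 2 * \<bar>v \<bullet> z2\<bar>"
    using w v by (simp_all add: obj3_def cpow_def)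
  then have "(w \<bullet> z1)\<^sup>2 = (v \<bullet> z2)\<^sup>2" using same[OF w(1) v(1)] by (simp add: abs_eq_iff) (auto simp: power2_eq_iff)
  moreover have "p * \<Delta>\<^sup>2 \<noteq> 0" using p \<Delta> by simp
  ultimately have iso: "z1 \<bullet> z1 = z2 \<bullet> z2" using wz vz by auto
  define s c where "s = z1 \<bullet> z1" and "c = z1 \<bullet> z2"
  have zz: "z1 \<bullet> z1 = s" "z2 \<bullet> z2 = s" "z1 \<bullet> z2 = c" "z2 \<bullet> z1 = c"
    by (simp_all add: s_def c_def iso inner_commute)
  have sc: "(s - c) * (s + c) = \<Delta>\<^sup>2"
    using Lagrange_identity_2[of z1 z2] by (simp add: zz \<Delta>_def power2_eq_square algebra_simps)
  have "s \<ge> 0" by (simp add: s_def)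
  moreover have "(s - c) * (s + c) > 0" using sc \<Delta> by simp
  ultimately have scp: "s + c > 0" "s - c > 0" by (auto simp: zero_less_mult_iff)
  \<comment> \<open>\<open>l\<close> is the coefficient in \<open>u = l *\<^sub>R (z1 + z2)\<close>,
    since \<open>(z1 + z2) \<bullet> z1 = s + c\<close>.\<close>
  define l where "l = (u \<bullet> z1) / (s + c)"
  have ul: "u \<bullet> z1 = l * (s + c)" "u \<bullet> z2 = l * (s + c)"
    using scp u(2,3) by (auto simp: l_def cpow_def)
  have "u - l *\<^sub>R (z1 + z2) = 0"
    by (rule orthogonal_both_zero[OF \<Delta>[unfolded \<Delta>_def]])
       (simp_all add: inner_diff inner_add zz ul algebra_simps)
  then have ue: "u = l *\<^sub>R (z1 + z2)" by simp
  have uu: "u \<bullet> u = 2 * l\<^sup>2 * (s + c)"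
    by (simp add: ue inner_add zz power2_eq_square algebra_simps)
  have pl: "p = 2 * (s + c) * (l * (l - 1))"
    using u(2) by (simp add: cpow_def uu ul power2_eq_square algebra_simps)
  have Ou: "obj3 p z1 z2 z3 u = 2 * (s + c) * \<bar>l\<bar>"
  proof -
    have "cpow p z3 u = 2 * (s + c) * l"
      unfolding cpow_def z3 uu pl by (simp add: power2_eq_square algebra_simps)
    then show ?thesis using u(2,3) scp by (simp add: obj3_def abs_mult)
  qed
  \<comment> \<open>\<open>x\<close> is the other point with vanishing first two powers, as
    \<open>l * (l - 1)\<close> is invariant under replacing \<open>l\<close> by
    \<open>1 - l\<close>. Minimality of \<open>u\<close> against \<open>x\<close> excludes
    \<open>l > 1\<close>.\<close>
  define x where "x = (1 - l) *\<^sub>R (z1 + z2)"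
  have x: "x \<bullet> z1 = (1 - l) * (s + c)" "x \<bullet> z2 = (1 - l) * (s + c)"
    "x \<bullet> x = 2 * (1 - l)\<^sup>2 * (s + c)"
    by (simp_all add: x_def inner_add zz power2_eq_square algebra_simps)
  have Ox: "obj3 p z1 z2 z3 x = 2 * (s + c) * \<bar>1 - l\<bar>"
  proof -
    have "cpow p z3 x = 2 * (s + c) * (1 - l)" "cpow p z1 x = 0" "cpow p z2 x = 0"
      unfolding cpow_def z3 x pl by (simp_all add: power2_eq_square algebra_simps)
    then show ?thesis using scp by (simp add: obj3_def abs_mult)
  qed
  have "obj3 p z1 z2 z3 u \<le> obj3 p z1 z2 z3 x" using u(1) by (simp add: mins3_def)
  then have ll: "\<bar>l\<bar> \<le> \<bar>1 - l\<bar>" using scp unfolding Ou Ox by simp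
  have "l * (l - 1) > 0" using pl p scp by (simp add: zero_less_mult_iff)
  with ll have l0: "l < 0" by (auto simp: zero_less_mult_iff)
  have "(s + c) * \<bar>l\<bar> = \<bar>w \<bullet> z1\<bar>" using same[OF u(1) w(1)] Ou Ow by linarith
  then have "((s + c) * l)\<^sup>2 = (w \<bullet> z1)\<^sup>2"
    using scp by (metis abs_mult abs_of_pos power2_abs)
  then have "p * ((s - c) * (s + c)) = ((s + c) * l)\<^sup>2 * s" using wz by (simp add: sc zz)
  then have "((s + c) * (s + c) * l) * (2 * (l - 1) * (s - c)) = ((s + c) * (s + c) * l) * (l * s)"
    unfolding pl by algebra
  then have "2 * (l - 1) * (s - c) = l * s" using scp l0 by simp
  then show thesis
    by (intro that[of "- l"]) (use z3 iso l0 in \<open>simp_all add: zz pl algebra_simps\<close>)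
qed

section \<open>The symmetric configuration has five minimizers\<close>

text \<open>The octahedron of radius \<open>r\<close> has horizontal axes \<open>e1\<close>,
  \<open>e2\<close> and a third axis \<open>(e3, r)\<close>. Both ends of the horizontal axes touch
  the paraboloid, but only the lower end \<open>- e3\<close> of the third does.\<close>

lemma configuration_card_5:
  assumes nd: "cross2 z1 z2 \<noteq> 0" and iso: "z1 \<bullet> z1 = z2 \<bullet> z2" and \<mu>: "\<mu> > 0"
    and \<mu>_eq: "\<mu> * (z1 \<bullet> z1) = 2 * (\<mu> + 1) * (z1 \<bullet> z1 - z1 \<bullet> z2)"
    and p_eq: "p = 2 * (z1 \<bullet> z1 + z1 \<bullet> z2) * \<mu> * (\<mu> + 1)"
  shows "card (mins3 p z1 z2 0) = 5"
proof -
  define s c where "s = z1 \<bullet> z1" and "c = z1 \<bullet> z2"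
  have zz: "z1 \<bullet> z1 = s" "z2 \<bullet> z2 = s" "z1 \<bullet> z2 = c" "z2 \<bullet> z1 = c"
    by (simp_all add: s_def c_def iso inner_commute)
  have sc: "(s - c) * (s + c) = (cross2 z1 z2)\<^sup>2"
    using Lagrange_identity_2[of z1 z2] by (simp add: zz power2_eq_square algebra_simps)
  have "s \<ge> 0" by (simp add: s_def)
  moreover have "(s - c) * (s + c) > 0" using sc nd by simp
  ultimately have scp: "s + c > 0" "s - c > 0" by (auto simp: zero_less_mult_iff)
  have pe: "p = 2 * (s + c) * \<mu> * (\<mu> + 1)" and me: "\<mu> * s = 2 * (\<mu> + 1) * (s - c)"
    using p_eq \<mu>_eq by (simp_all add: zz)
  have p: "p > 0" using pe scp \<mu> by simp
  define r where "r = 2 * \<mu> * (s + c)"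
  have r: "r > 0" using \<mu> scp by (simp add: r_def)
  obtain e1 where e1: "e1 \<bullet> z1 = - r / 2" "e1 \<bullet> z2 = 0"
    using linear_system_solvable[OF nd] by metis
  obtain e2 where e2: "e2 \<bullet> z1 = 0" "e2 \<bullet> z2 = - r / 2"
    using linear_system_solvable[OF nd] by metis
  define e3 where "e3 = \<mu> *\<^sub>R (z1 + z2)"
  have e3: "e3 \<bullet> z1 = r / 2" "e3 \<bullet> z2 = r / 2" "e3 \<bullet> e3 = 2 * \<mu>\<^sup>2 * (s + c)"
    by (simp_all add: e3_def r_def inner_add zz power2_eq_square algebra_simps)
  \<comment> \<open>Here the equation for \<open>\<mu>\<close> enters: it makes the horizontal axes
    have squared length exactly \<open>p\<close>.\<close>
  have "(r / 2)\<^sup>2 * s = p * (cross2 z1 z2)\<^sup>2"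
    using me unfolding sc[symmetric] r_def pe by algebra
  then have "(e1 \<bullet> e1) * (cross2 z1 z2)\<^sup>2 = p * (cross2 z1 z2)\<^sup>2"
    "(e2 \<bullet> e2) * (cross2 z2 z1)\<^sup>2 = p * (cross2 z2 z1)\<^sup>2"
    using inner_self_of_orthogonal[OF e1(2), of z1] inner_self_of_orthogonal[OF e2(1), of z2] e1 e2
    by (simp_all add: zz cross2_commute[of z2])
  then have ee: "e1 \<bullet> e1 = p" "e2 \<bullet> e2 = p" using nd by (simp_all add: cross2_commute[of z2])
  have ee3: "e3 \<bullet> e3 + r = p" unfolding e3 r_def pe by (simp add: power2_eq_square algebra_simps)
  note bound = octahedron_bound[where ?z1.0 = z1 and ?z2.0 = z2 and ?z3.0 = 0 and r = r and p = p
      and ?s1.0 = 0 and ?s2.0 = 0 and ?s3.0 = r and ?e1.0 = e1 and ?e2.0 = e2 and ?e3.0 = e3]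
  have ge: "r \<le> obj3 p z1 z2 0 w" for w
    by (rule bound(1)) (use nd r p e1 e2 e3(1,2) ee ee3 in auto)
  have van: "cpow p z1 w * cpow p z2 w = 0 \<and> cpow p z1 w * cpow p 0 w = 0 \<and> cpow p z2 w * cpow p 0 w = 0"
    if "obj3 p z1 z2 0 w = r" for w
    by (rule bound(2)) (use nd r p e1 e2 e3(1,2) ee ee3 that in auto)
  have uniq: "x = y" if "x \<bullet> z1 = y \<bullet> z1" "x \<bullet> z2 = y \<bullet> z2" for x y
    using orthogonal_both_zero[OF nd, of "x - y"] that by (simp add: inner_diff)
  have val: "obj3 p z1 z2 0 w = r" if "w \<in> {e1, - e1, e2, - e2, - e3}" for w
    using that r e1 e2 e3(1,2) ee ee3 unfolding obj3_def cpow_def by auto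
  have "mins3 p z1 z2 0 = {w. obj3 p z1 z2 0 w = r}"
    using ge val[of e1] unfolding mins3_def by (auto intro: antisym)
  also have "\<dots> = {e1, - e1, e2, - e2, - e3}"
  proof (intro equalityI subsetI)
    fix w assume "w \<in> {w. obj3 p z1 z2 0 w = r}"
    then have w: "obj3 p z1 z2 0 w = r" by simp
    then consider "cpow p z2 w = 0" "cpow p 0 w = 0" | "cpow p z1 w = 0" "cpow p 0 w = 0"
      | "cpow p z1 w = 0" "cpow p z2 w = 0" using van by fastforce
    then show "w \<in> {e1, - e1, e2, - e2, - e3}"
    proof cases
      case 1
      then have *: "w \<bullet> z2 = 0" "\<bar>w \<bullet> z1\<bar> = r / 2" using w by (auto simp: cpow_def obj3_def)
      then consider "w \<bullet> z1 = e1 \<bullet> z1" | "w \<bullet> z1 = (- e1) \<bullet> z1"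
        unfolding inner_minus_left e1 by linarith
      then have "w = e1 \<or> w = - e1"
        by cases (use *(1) e1 in \<open>auto intro!: uniq\<close>)
      then show ?thesis by blast
    next
      case 2
      then have *: "w \<bullet> z1 = 0" "\<bar>w \<bullet> z2\<bar> = r / 2" using w by (auto simp: cpow_def obj3_def)
      then consider "w \<bullet> z2 = e2 \<bullet> z2" | "w \<bullet> z2 = (- e2) \<bullet> z2"
        unfolding inner_minus_left e2 by linarith
      then have "w = e2 \<or> w = - e2"
        by cases (use *(1) e2 in \<open>auto intro!: uniq\<close>)
      then show ?thesis by blast
    next
      case 3
      then have *: "w \<bullet> z2 = w \<bullet> z1" "\<bar>w \<bullet> z1\<bar> = r / 2" using w by (auto simp: cpow_def obj3_def)
      then consider "w \<bullet> z1 = e3 \<bullet> z1" | "w \<bullet> z1 = (- e3) \<bullet> z1"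
        unfolding inner_minus_left e3 by linarith
      then have "w = e3 \<or> w = - e3"
        by cases (use *(1) e3 in \<open>auto intro!: uniq\<close>)
      \<comment> \<open>The upper vertex of the third axis is off the paraboloid: the first power at
        \<open>e3\<close> is \<open>- 2 * r\<close>.\<close>
      moreover have "w \<noteq> e3" using 3(1) ee3 e3(1) r by (auto simp: cpow_def)
      ultimately show ?thesis by blast
    qed
  qed (use val in auto)
  also have "card \<dots> = 5"
  proof -
    have "x \<noteq> y" if "x \<bullet> z1 \<noteq> y \<bullet> z1 \<or> x \<bullet> z2 \<noteq> y \<bullet> z2" for x y using that by auto
    then have "distinct [e1, - e1, e2, - e2, - e3]"
      using e1 e2 e3(1,2) r by simp
    then have "card (set [e1, - e1, e2, - e2, - e3]) = 5" by (subst distinct_card) simp_all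
    then show ?thesis by simp
  qed
  finally show ?thesis .
qed

section \<open>Translation to side lengths and radii\<close>

lemma five_point_conditions_sufficient:
  fixes Z :: "nat \<Rightarrow> real^2"
  assumes nd: "cross2 (Z 1 - Z 3) (Z 2 - Z 3) \<noteq> 0" and d: "d 1 > 0" "d 2 > 0" "d 3 > 0"
    and five: "five_point_conditions (Z 1) (Z 2) (Z 3) (d 1) (d 2) (d 3)"
  shows "card (global_minimizers Z d) = 5"
proof -
  define z1 z2 where "z1 = Z 1 - Z 3" and "z2 = Z 2 - Z 3"
  define s c D where "s = z1 \<bullet> z1" and "c = z1 \<bullet> z2" and "D = 2 * (s - c)"
  have ds: "(dist (Z 1) (Z 3))\<^sup>2 = s" "(dist (Z 2) (Z 3))\<^sup>2 = z2 \<bullet> z2"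
    by (simp_all add: dist_norm power2_norm_eq_inner s_def z1_def z2_def)
  have iso: "z1 \<bullet> z1 = z2 \<bullet> z2" using five ds unfolding five_point_conditions_def s_def by metis
  have dD: "(dist (Z 1) (Z 2))\<^sup>2 = D"
  proof -
    have "Z 1 - Z 2 = z1 - z2" by (simp add: z1_def z2_def)
    then show ?thesis using iso
      by (simp add: dist_norm power2_norm_eq_inner D_def s_def c_def inner_diff inner_commute)
  qed
  have "dist (Z 1) (Z 2) < dist (Z 1) (Z 3)" and
    d1: "(d 1)\<^sup>2 = D / 4 + (s - D / 4) * ((s + D) / (s - D))\<^sup>2" and
    d3: "d 3 = sqrt ((d 1)\<^sup>2 - s)" and d2: "d 2 = d 1"
    using five unfolding five_point_conditions_def ds dD by auto
  then have sD: "D < s" using power_strict_mono[of "dist (Z 1) (Z 2)" "dist (Z 1) (Z 3)" 2] ds dD by simp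
  \<comment> \<open>\<open>sqrt\<close> is negative on negative reals, so \<open>d 3 > 0\<close>
    makes its argument positive.\<close>
  have "(d 1)\<^sup>2 - s > 0" using d3 d(3) by simp
  then have p: "(d 3)\<^sup>2 = (d 1)\<^sup>2 - s" by (simp add: d3)
  have "D > 0" using nd unfolding dD[symmetric] by (auto simp: cross2_def)
  \<comment> \<open>This solves \<open>\<mu> * s = (\<mu> + 1) * D\<close>. The factor in the
    formula for \<open>d 1\<close> becomes \<open>1 + 2 * \<mu>\<close>, with square
    \<open>1 + 4 * \<mu> * (\<mu> + 1)\<close>; as \<open>s - D / 4 = (s + c) / 2\<close>, the
    formula reads \<open>s + 2 * (s + c) * \<mu> * (\<mu> + 1)\<close>.\<close>
  define \<mu> where "\<mu> = D / (s - D)"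
  have \<mu>: "\<mu> > 0" using \<open>D > 0\<close> sD by (simp add: \<mu>_def)
  have \<mu>_eq: "\<mu> * s = (\<mu> + 1) * D" using sD by (simp add: \<mu>_def field_simps)
  have "(s + D) / (s - D) = 1 + 2 * \<mu>" using sD by (simp add: \<mu>_def field_simps)
  then have p_eq: "(d 3)\<^sup>2 = 2 * (s + c) * \<mu> * (\<mu> + 1)"
    unfolding p d1 by (simp add: D_def power2_eq_square field_simps)
  have "card (mins3 ((d 3)\<^sup>2) z1 z2 0) = 5"
    by (rule configuration_card_5[where \<mu> = \<mu>])
       (use nd iso \<mu> \<mu>_eq p_eq in \<open>simp_all add: z1_def z2_def s_def c_def D_def algebra_simps\<close>)
  moreover have "(d j)\<^sup>2 = (Z j - Z 3) \<bullet> (Z j - Z 3) + (d 3)\<^sup>2" if "j \<in> {1,2,3}" for j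
  proof -
    have "(d 1)\<^sup>2 = z1 \<bullet> z1 + (d 3)\<^sup>2" "(d 2)\<^sup>2 = z2 \<bullet> z2 + (d 3)\<^sup>2"
      using p d2 iso by (simp_all add: s_def)
    then show ?thesis using that by (auto simp: z1_def z2_def)
  qed
  then have "card (global_minimizers Z d) = card (mins3 ((d 3)\<^sup>2) z1 z2 (Z 3 - Z 3))"
    unfolding z1_def z2_def by (rule card_global_minimizers)
  ultimately show ?thesis by simp
qed

text \<open>The three cardinalities count minimizers on the octahedron axes: two axes are full and
  the third is not empty. The resulting configuration has \<open>W0 = Z3\<close>, and its equation
  for \<open>\<mu>\<close> is solved in terms of side lengths.\<close>

lemma five_point_conditions_necessary:
  fixes Z1 Z2 Z3 W0 :: "real^2" and p :: real
  defines "M \<equiv> mins3 p (Z1 - W0) (Z2 - W0) (Z3 - W0)"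
  assumes nd: "cross2 (Z1 - Z3) (Z2 - Z3) \<noteq> 0" and p: "p > 0"
    and d: "d1 > 0" "d2 > 0" "d3 > 0"
    and d1: "d1\<^sup>2 = (Z1 - W0) \<bullet> (Z1 - W0) + p"
    and d2: "d2\<^sup>2 = (Z2 - W0) \<bullet> (Z2 - W0) + p"
    and d3: "d3\<^sup>2 = (Z3 - W0) \<bullet> (Z3 - W0) + p"
    and w: "card {w \<in> M. cpow p (Z2 - W0) w = 0 \<and> cpow p (Z3 - W0) w = 0} = 2"
    and v: "card {w \<in> M. cpow p (Z1 - W0) w = 0 \<and> cpow p (Z3 - W0) w = 0} = 2"
    and u: "card {w \<in> M. cpow p (Z1 - W0) w = 0 \<and> cpow p (Z2 - W0) w = 0} \<noteq> 0"
  shows "five_point_conditions Z1 Z2 Z3 d1 d2 d3"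
proof -
  define z1 z2 z3 where "z1 = Z1 - W0" and "z2 = Z2 - W0" and "z3 = Z3 - W0"
  have nd': "cross2 (z1 - z3) (z2 - z3) \<noteq> 0" "cross2 (z2 - z3) (z1 - z3) \<noteq> 0"
    using nd by (simp_all add: z1_def z2_def z3_def cross2_commute[of "Z2 - Z3"])
  obtain w w' where "w \<in> mins3 p z1 z2 z3" "cpow p z2 w = 0" "cpow p z3 w = 0"
    "w' \<in> mins3 p z1 z2 z3" "cpow p z2 w' = 0" "cpow p z3 w' = 0" "w \<noteq> w'"
    using w unfolding card_2_iff M_def z1_def z2_def z3_def by blast
  note w = this(1) antipodal_minimizers(2-4)[OF nd'(1) this]
  obtain v v' where v: "v \<in> mins3 p z1 z2 z3" "cpow p z1 v = 0" "cpow p z3 v = 0"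
    "v' \<in> mins3 p z1 z2 z3" "cpow p z1 v' = 0" "cpow p z3 v' = 0" "v \<noteq> v'"
    using v unfolding card_2_iff M_def z1_def z2_def z3_def by blast
  note v = v(1) antipodal_minimizers(2-4)[OF nd'(2) v[unfolded mins3_swap[of p z1 z2 z3]]]
  obtain u where u: "u \<in> mins3 p z1 z2 z3" "cpow p z1 u = 0" "cpow p z2 u = 0"
    using u unfolding M_def z1_def z2_def z3_def by (metis (mono_tags, lifting) card.empty empty_Collect_eq)
  obtain \<mu> where z3: "z3 = 0" and iso: "z1 \<bullet> z1 = z2 \<bullet> z2" and \<mu>: "\<mu> > 0"
    and \<mu>_eq: "\<mu> * (z1 \<bullet> z1) = 2 * (\<mu> + 1) * (z1 \<bullet> z1 - z1 \<bullet> z2)"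
    and p_eq: "p = 2 * (z1 \<bullet> z1 + z1 \<bullet> z2) * \<mu> * (\<mu> + 1)"
    by (rule five_minimizers_configuration[OF nd'(1) p w v u])
  have W0: "W0 = Z3" using z3 by (simp add: z3_def)
  define s c D where "s = z1 \<bullet> z1" and "c = z1 \<bullet> z2" and "D = 2 * (s - c)"
  have ds: "(dist Z1 Z3)\<^sup>2 = s" "(dist Z2 Z3)\<^sup>2 = s"
    using iso by (simp_all add: dist_norm power2_norm_eq_inner s_def z1_def z2_def W0)
  have dD: "(dist Z1 Z2)\<^sup>2 = D"
  proof -
    have "Z1 - Z2 = z1 - z2" by (simp add: z1_def z2_def)
    then show ?thesis using iso
      by (simp add: dist_norm power2_norm_eq_inner D_def s_def c_def inner_diff inner_commute)
  qed
  have m: "\<mu> * s = (\<mu> + 1) * D" using \<mu>_eq by (simp add: s_def c_def D_def algebra_simps)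
  have "s > 0" using nd unfolding ds(1)[symmetric] by (auto simp: cross2_def)
  then have "(\<mu> + 1) * D > 0" using m \<mu> by (metis mult_pos_pos)
  then have "D > 0" using \<mu> by (simp add: zero_less_mult_iff)
  then have "\<mu> * (s - D) > 0" using m by (simp add: algebra_simps)
  then have sD: "D < s" using \<mu> by (simp add: zero_less_mult_iff)
  have me: "\<mu> = D / (s - D)" using m sD by (simp add: field_simps)
  have "dist Z1 Z3 = dist Z2 Z3" using ds by (metis zero_le_dist power2_eq_imp_eq)
  moreover have "dist Z1 Z2 < dist Z1 Z3" using sD ds dD by (metis zero_le_dist power2_less_imp_less)
  moreover have "d1\<^sup>2 = D / 4 + (s - D / 4) * ((s + D) / (s - D))\<^sup>2"
  proof -
    have "(s + D) / (s - D) = 1 + 2 * \<mu>" using sD by (simp add: me field_simps)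
    then show ?thesis
      unfolding d1 z1_def[symmetric] s_def[symmetric] p_eq c_def[symmetric]
      by (simp add: D_def power2_eq_square field_simps)
  qed
  moreover have "d3 = sqrt (d1\<^sup>2 - s)"
  proof -
    have "d3\<^sup>2 = d1\<^sup>2 - s" using d1 d3 by (simp add: W0 s_def z1_def)
    then show ?thesis using d by (metis real_sqrt_abs abs_of_pos)
  qed
  moreover have "d2 = d1"
  proof -
    have "d2\<^sup>2 = d1\<^sup>2" using d1 d2 iso by (simp add: z1_def z2_def)
    then show ?thesis using d by (simp add: power2_eq_iff)
  qed
  ultimately show ?thesis unfolding five_point_conditions_def ds dD by simp
qed

section \<open>Counting minimizers and relabelling the vertices\<close>

text \<open>Any minimizer on the axis other than a given \<open>w\<close> is
  \<open>- w\<close>.\<close>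

lemma card_vertex_pair_le_2:
  assumes nd: "cross2 (z1 - z3) (z2 - z3) \<noteq> 0"
  shows "card {w \<in> mins3 p z1 z2 z3. cpow p z2 w = 0 \<and> cpow p z3 w = 0} \<le> 2" (is "card ?S \<le> 2")
proof (cases "?S = {}")
  case False
  then obtain w where w: "w \<in> ?S" by blast
  have "?S \<subseteq> {w, - w}"
    using antipodal_minimizers(1)[OF nd] w by blast
  then have "card ?S \<le> card {w, - w}" by (intro card_mono) auto
  also have "\<dots> \<le> 2" by (simp add: card_insert_if)
  finally show ?thesis .
qed (simp only: card.empty)

lemma global_minimizers_permute:
  assumes "\<pi> permutes {1..3}"
  shows "global_minimizers (Z \<circ> \<pi>) (d \<circ> \<pi>) = global_minimizers Z d"
proof -
  have "objective (Z \<circ> \<pi>) (d \<circ> \<pi>) W = objective Z d W" for W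
    using sum.permute[OF assms, of "\<lambda>j. \<bar>(dist W (Z j))\<^sup>2 - (d j)\<^sup>2\<bar>"]
    by (simp add: objective_def o_def)
  then show ?thesis by (simp add: global_minimizers_def)
qed

theorem corollary4:
  fixes Z :: "nat \<Rightarrow> real^2" and d :: "nat \<Rightarrow> real"
  assumes triangle: "\<not> collinear {Z 1, Z 2, Z 3}"
    and d_pos: "d 1 > 0" "d 2 > 0" "d 3 > 0"
  shows "card (global_minimizers Z d) = 5 \<longleftrightarrow>
    (\<exists>p. p permutes {1..3} \<and>
      five_point_conditions (Z (p 1)) (Z (p 2)) (Z (p 3)) (d (p 1)) (d (p 2)) (d (p 3)))"
proof
  assume "\<exists>p. p permutes {1..3} \<and>
      five_point_conditions (Z (p 1)) (Z (p 2)) (Z (p 3)) (d (p 1)) (d (p 2)) (d (p 3))"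
  then obtain \<pi> where \<pi>: "\<pi> permutes {1..3}"
    "five_point_conditions (Z (\<pi> 1)) (Z (\<pi> 2)) (Z (\<pi> 3)) (d (\<pi> 1)) (d (\<pi> 2)) (d (\<pi> 3))" by blast
  have I: "{1..3} = {1, 2, 3::nat}" by auto
  have "\<pi> ` {1, 2, 3} = {1, 2, 3}" using permutes_image[OF \<pi>(1)] unfolding I .
  then have im: "{\<pi> 1, \<pi> 2, \<pi> 3} = {1, 2, 3}" by simp
  then have "{Z (\<pi> 1), Z (\<pi> 2), Z (\<pi> 3)} = {Z 1, Z 2, Z 3}"
    by (metis image_insert image_empty)
  then have "cross2 (Z (\<pi> 1) - Z (\<pi> 3)) (Z (\<pi> 2) - Z (\<pi> 3)) \<noteq> 0"
    using triangle by (intro cross2_nonzero) simp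
  moreover have "d (\<pi> j) > 0" if "j \<in> {1, 2, 3}" for j
  proof -
    have "\<pi> j \<in> {1, 2, 3}" using im that by blast
    then show ?thesis using d_pos by auto
  qed
  ultimately have "card (global_minimizers (Z \<circ> \<pi>) (d \<circ> \<pi>)) = 5"
    using \<pi>(2) by (intro five_point_conditions_sufficient) (simp_all del: One_nat_def)
  then show "card (global_minimizers Z d) = 5"
    by (simp add: global_minimizers_permute[OF \<pi>(1)])
next
  assume five: "card (global_minimizers Z d) = 5"
  \<comment> \<open>One form of nondegeneracy for each choice of the apex: \<open>Z 3\<close>,
    \<open>Z 2\<close> and \<open>Z 1\<close>.\<close>
  have nd: "cross2 (Z 1 - Z 3) (Z 2 - Z 3) \<noteq> 0" "cross2 (Z 1 - Z 2) (Z 3 - Z 2) \<noteq> 0"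
    "cross2 (Z 3 - Z 1) (Z 2 - Z 1) \<noteq> 0"
    by (rule cross2_nonzero; use triangle in \<open>simp add: insert_commute\<close>)+
  obtain W0 p where d1: "(d 1)\<^sup>2 = (Z 1 - W0) \<bullet> (Z 1 - W0) + p"
    and d2: "(d 2)\<^sup>2 = (Z 2 - W0) \<bullet> (Z 2 - W0) + p"
    and d3: "(d 3)\<^sup>2 = (Z 3 - W0) \<bullet> (Z 3 - W0) + p"
    using radical_center_exists[OF nd(1)] by metis
  define z1 z2 z3 where "z1 = Z 1 - W0" and "z2 = Z 2 - W0" and "z3 = Z 3 - W0"
  have ndz: "cross2 (z1 - z3) (z2 - z3) \<noteq> 0" "cross2 (z2 - z3) (z1 - z3) \<noteq> 0"
    "cross2 (z3 - z2) (z1 - z2) \<noteq> 0"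
    using nd by (simp_all add: z1_def z2_def z3_def cross2_commute[of "Z 2 - Z 3"]
      cross2_commute[of "Z 3 - Z 2"])
  define M where "M = mins3 p z1 z2 z3"
  have "card (global_minimizers Z d) = card (mins3 p (Z 1 - W0) (Z 2 - W0) (Z 3 - W0))"
    by (rule card_global_minimizers) (use d1 d2 d3 in auto)
  with five have cM: "card M = 5" by (simp add: M_def z1_def z2_def z3_def)
  \<comment> \<open>\<open>card\<close> of an infinite set is 0.\<close>
  then have finM: "finite M" by (metis card.infinite zero_neq_numeral)
  have p: "p > 0"
  proof (rule ccontr)
    assume "\<not> p > 0"
    then have "card M \<le> Suc 0"
      unfolding card_le_Suc0_iff_eq[OF finM] 
      by (auto simp: M_def intro: mins3_unique[OF ndz(1), of p])
    then show False using cM by simp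
  qed
  have M_perm: "mins3 p z1 z3 z2 = M" "mins3 p z2 z1 z3 = M" "mins3 p z3 z2 z1 = M" "mins3 p z3 z1 z2 = M"
    unfolding M_def by (metis mins3_rotate mins3_swap)+
  define S1 S2 S3 where "S1 = {w \<in> M. cpow p z2 w = 0 \<and> cpow p z3 w = 0}"
    and "S2 = {w \<in> M. cpow p z1 w = 0 \<and> cpow p z3 w = 0}"
    and "S3 = {w \<in> M. cpow p z1 w = 0 \<and> cpow p z2 w = 0}"
  have "M \<subseteq> S1 \<union> S2 \<union> S3"
    using two_powers_vanish[OF ndz(1) p] unfolding S1_def S2_def S3_def M_def by fastforce
  moreover have "finite (S1 \<union> S2 \<union> S3)" using finM by (auto simp: S1_def S2_def S3_def)
  ultimately have "card M \<le> card (S1 \<union> S2 \<union> S3)" by (rule card_mono[rotated])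
  also have "\<dots> \<le> card S1 + card S2 + card S3"
    by (meson card_Un_le add_right_mono order_trans)
  finally have "5 \<le> card S1 + card S2 + card S3" using cM by simp
  moreover have "card S1 \<le> 2" "card S2 \<le> 2" "card S3 \<le> 2"
    using card_vertex_pair_le_2[OF ndz(1), of p] card_vertex_pair_le_2[OF ndz(2), of p]
      card_vertex_pair_le_2[OF ndz(3), of p]
    unfolding M_perm S1_def S2_def S3_def M_def[symmetric] by simp_all
  \<comment> \<open>Three numbers at most 2 with sum at least 5: two equal 2 and the third is
    positive. The axis that need not be full determines the apex.\<close>
  ultimately consider "card S1 = 2" "card S2 = 2" "card S3 \<noteq> 0"
    | "card S1 = 2" "card S3 = 2" "card S2 \<noteq> 0" | "card S3 = 2" "card S2 = 2" "card S1 \<noteq> 0"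
    by linarith
  then show "\<exists>p. p permutes {1..3} \<and>
      five_point_conditions (Z (p 1)) (Z (p 2)) (Z (p 3)) (d (p 1)) (d (p 2)) (d (p 3))"
  proof cases
    case 1
    have "five_point_conditions (Z 1) (Z 2) (Z 3) (d 1) (d 2) (d 3)"
      by (rule five_point_conditions_necessary[OF nd(1) p d_pos(1,2,3) d1 d2 d3];
          fold z1_def z2_def z3_def; fold M_def;
          use 1 in \<open>simp add: S1_def S2_def S3_def conj_commute\<close>)
    then show ?thesis by (intro exI[of _ id]) (simp add: permutes_id)
  next
    case 2
    have "five_point_conditions (Z 1) (Z 3) (Z 2) (d 1) (d 3) (d 2)"
      by (rule five_point_conditions_necessary[OF nd(2) p d_pos(1,3,2) d1 d3 d2];
          fold z1_def z2_def z3_def; unfold M_perm;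
          use 2 in \<open>simp add: S1_def S2_def S3_def conj_commute\<close>)
    then show ?thesis
      by (intro exI[of _ "Transposition.transpose 2 3"]) (auto intro!: permutes_swap_id simp: Transposition.transpose_def)
  next
    case 3
    have "five_point_conditions (Z 3) (Z 2) (Z 1) (d 3) (d 2) (d 1)"
      by (rule five_point_conditions_necessary[OF nd(3) p d_pos(3,2,1) d3 d2 d1];
          fold z1_def z2_def z3_def; unfold M_perm;
          use 3 in \<open>simp add: S1_def S2_def S3_def conj_commute\<close>)
    then show ?thesis
      by (intro exI[of _ "Transposition.transpose 1 3"]) (auto intro!: permutes_swap_id simp: Transposition.transpose_def)
  qed
qed

end
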